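(* Let $\mathcal H,\mathcal G$ be real Hilbert spaces, $C:\mathcal H\to\mathcal G$ a continuous linear map with adjoint $C^*$, $u:\mathcal H\to(-\infty,+\infty]$ and $v:\mathcal G\to(-\infty,+\infty]$ proper closed convex functions with convex conjugates $u^*,v^*$, and $\lambda>0$. Consider the iteration (ADM on the primal problem, in variables $x,s,y,z_s,z_y$), for $k=0,1,\dots$: $$\begin{aligned} x^{k+1}&=\operatorname*{arg\,min}_x\|x-s^k+\lambda z_s^k\|^2+\|Cx-y^k+\lambda z_y^k\|^2,\\ s^{k+1}&=\operatorname*{arg\,min}_s u(s)+\tfrac1{2\lambda}\|x^{k+1}-s+\lambda z_s^k\|^2,\\ y^{k+1}&=\operatorname*{arg\,min}_y v(y)+\tfrac1{2\lambda}\|Cx^{k+1}-y+\lambda z_y^k\|^2,\\ z_s^{k+1}&=z_s^k+\lambda^{-1}(x^{k+1}-s^{k+1}),\\ z_y^{k+1}&=z_y^k+\lambda^{-1}(Cx^{k+1}-y^{k+1}), \end{aligned}$$ and the iteration (ADM on the dual problem, in variables $\mathbf v,\mathbf u,t,z_u,z_t$), for $k=0,1,\dots$: $$\begin{aligned} \mathbf v^{k+1}&=\operatorname*{arg\,min}_{\mathbf v}\|C^*\mathbf v+\mathbf u^k+\lambda^{-1}z_u^k\|^2+\|\mathbf v-t^k+\lambda^{-1}z_t^k\|^2,\\ \mathbf u^{k+1}&=\operatorname*{arg\,min}_{\mathbf u}u^*(\mathbf u)+\tfrac\lambda2\|C^*\mathbf v^{k+1}+\mathbf u+\lambda^{-1}z_u^k\|^2,\\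 t^{k+1}&=\operatorname*{arg\,min}_t v^*(t)+\tfrac\lambda2\|\mathbf v^{k+1}-t+\lambda^{-1}z_t^k\|^2,\\ z_u^{k+1}&=z_u^k+\lambda(C^*\mathbf v^{k+1}+\mathbf u^{k+1}),\\ z_t^{k+1}&=z_t^k+\lambda(\mathbf v^{k+1}-t^{k+1}). \end{aligned}$$ If the initializations satisfy $z_y^0=t^0$, $z_s^0=\mathbf u^0$, $s^0=-z_u^0$ and $y^0=z_t^0$, then for all $k\ge1$, $$z_y^k=t^k,\qquad z_s^k=\mathbf u^k,\qquad s^k=-z_u^k,\qquad y^k=z_t^k.$$
   Context: The convex conjugate is $h^*(p)=\sup_x\{\langle p,x\rangle-h(x)\}$. The first iteration is ADM applied to: minimize $u(s)+v(y)$ subject to $Cx-y=0$, $x-s=0$. The second is ADM applied to: minimize $u^*(\mathbf u)+v^*(t)$ subject to $C^*\mathbf v+\mathbf u=0$, $\mathbf v-t=0$. Bold $\mathbf u,\mathbf v$ denote variables and plain $u,v$ denote functions. *)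

theory Defs
  imports "HOL-Analysis.Analysis"
begin

text \<open>
  The library constant \<^const>\<open>epigraph\<close> only covers real-valued functions; here the
  function is extended-real-valued and the heights are real numbers.
\<close>

definition ereal_epigraph :: "('a \<Rightarrow> ereal) \<Rightarrow> ('a \<times> real) set" where
  "ereal_epigraph f = {(x, r). f x \<le> ereal r}"

definition proper_fun :: "('a \<Rightarrow> ereal) \<Rightarrow> bool" where
  "proper_fun f \<longleftrightarrow> (\<forall>x. f x \<noteq> -\<infinity>) \<and> (\<exists>x. f x \<noteq> \<infinity>)"

definition closed_fun :: "('a::topological_space \<Rightarrow> ereal) \<Rightarrow> bool" where
  "closed_fun f \<longleftrightarrow> closed (ereal_epigraph f)"

definition convex_fun :: "('a::real_vector \<Rightarrow> ereal) \<Rightarrow> bool" where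
  "convex_fun f \<longleftrightarrow> convex (ereal_epigraph f)"

definition convex_conjugate :: "('a::real_inner \<Rightarrow> ereal) \<Rightarrow> 'a \<Rightarrow> ereal" where
  "convex_conjugate h p = (SUP x. ereal (p \<bullet> x) - h x)"

abbreviation minimizes :: "'a \<Rightarrow> ('a \<Rightarrow> 'b::ord) \<Rightarrow> bool" (infix "minimizes" 10) where
  "x minimizes f \<equiv> is_arg_min f (\<lambda>_. True) x"

text \<open>
  An equation ``iterate = arg min'' is read as: the iterate is a minimizer. The initial
  values of the first variable of each iteration (\<^term>\<open>x 0\<close> below, and likewise
  \<^term>\<open>bv 0\<close>) are never used. On Hilbert spaces the Riesz representation theorem
  makes \<^const>\<open>adjoint\<close> the adjoint of any bounded linear map.
\<close>

definition adm_primal ::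
  "('h::real_inner \<Rightarrow> 'g::real_inner) \<Rightarrow> ('h \<Rightarrow> ereal) \<Rightarrow> ('g \<Rightarrow> ereal) \<Rightarrow> real \<Rightarrow>
    (nat \<Rightarrow> 'h) \<Rightarrow> (nat \<Rightarrow> 'h) \<Rightarrow> (nat \<Rightarrow> 'g) \<Rightarrow> (nat \<Rightarrow> 'h) \<Rightarrow> (nat \<Rightarrow> 'g) \<Rightarrow> bool" where
  "adm_primal C u v lam x s y zs zy \<longleftrightarrow> (\<forall>k.
     (x (Suc k) minimizes
        (\<lambda>\<xi>. (norm (\<xi> - s k + lam *\<^sub>R zs k))\<^sup>2 + (norm (C \<xi> - y k + lam *\<^sub>R zy k))\<^sup>2)) \<and>
     (s (Suc k) minimizes
        (\<lambda>\<sigma>. u \<sigma> + ereal (1 / (2 * lam) * (norm (x (Suc k) - \<sigma> + lam *\<^sub>R zs k))\<^sup>2))) \<and>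
     (y (Suc k) minimizes
        (\<lambda>\<eta>. v \<eta> + ereal (1 / (2 * lam) * (norm (C (x (Suc k)) - \<eta> + lam *\<^sub>R zy k))\<^sup>2))) \<and>
     zs (Suc k) = zs k + inverse lam *\<^sub>R (x (Suc k) - s (Suc k)) \<and>
     zy (Suc k) = zy k + inverse lam *\<^sub>R (C (x (Suc k)) - y (Suc k)))"

definition adm_dual ::
  "('h::real_inner \<Rightarrow> 'g::real_inner) \<Rightarrow> ('h \<Rightarrow> ereal) \<Rightarrow> ('g \<Rightarrow> ereal) \<Rightarrow> real \<Rightarrow>
    (nat \<Rightarrow> 'g) \<Rightarrow> (nat \<Rightarrow> 'h) \<Rightarrow> (nat \<Rightarrow> 'g) \<Rightarrow> (nat \<Rightarrow> 'h) \<Rightarrow> (nat \<Rightarrow> 'g) \<Rightarrow> bool" where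
  "adm_dual C u v lam bv bu t zu zt \<longleftrightarrow> (\<forall>k.
     (bv (Suc k) minimizes
        (\<lambda>\<nu>. (norm (adjoint C \<nu> + bu k + inverse lam *\<^sub>R zu k))\<^sup>2
             + (norm (\<nu> - t k + inverse lam *\<^sub>R zt k))\<^sup>2)) \<and>
     (bu (Suc k) minimizes
        (\<lambda>\<mu>. convex_conjugate u \<mu>
             + ereal (lam / 2 * (norm (adjoint C (bv (Suc k)) + \<mu> + inverse lam *\<^sub>R zu k))\<^sup>2))) \<and>
     (t (Suc k) minimizes
        (\<lambda>\<tau>. convex_conjugate v \<tau>
             + ereal (lam / 2 * (norm (bv (Suc k) - \<tau> + inverse lam *\<^sub>R zt k))\<^sup>2))) \<and>
     zu (Suc k) = zu k + lam *\<^sub>R (adjoint C (bv (Suc k)) + bu (Suc k)) \<and>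
     zt (Suc k) = zt k + lam *\<^sub>R (bv (Suc k) - t (Suc k)))"

end

theory Submission
  imports Defs
begin

text \<open>
  Both coupled quadratic subproblems are strictly convex; comparing their optimality conditions
  (with \<open>a = s - \<lambda> z\<^sub>s\<close> and \<open>b = y - \<lambda> z\<^sub>y\<close>) yields \<open>\<lambda> \<nu> = C x - b\<close> and \<open>x = a - \<lambda> C\<^sup>* \<nu>\<close>. The remaining
  subproblems are then proximal steps of \<open>u\<close>, \<open>u\<^sup>*\<close> (and \<open>v\<close>, \<open>v\<^sup>*\<close>) at matching points, so
  Moreau's decomposition \<open>p = prox\<^bsub>\<lambda>u\<^esub> p + \<lambda> prox\<^bsub>u\<^sup>*/\<lambda>\<^esub> (p/\<lambda>)\<close> carries the four identities from
  one iterate to the next. The adjoint exists by the Riesz representation theorem, obtained by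
  minimizing \<open>\<parallel>x\<parallel>\<^sup>2/2 - f x\<close>.
\<close>

section \<open>First-order optimality along a segment\<close>

text \<open>Divide by \<open>t\<close> and let \<open>t\<close> tend to 0 from the right. This is
  the derivative test behind every optimality condition below; \<open>t \<le> 1\<close> keeps convex
  combinations available.\<close>

lemma first_order_nonneg:
  fixes a b :: real
  assumes "\<And>t. 0 < t \<Longrightarrow> t \<le> 1 \<Longrightarrow> 0 \<le> t * a + t\<^sup>2 * b"
  shows "0 \<le> a"
proof (rule tendsto_lowerbound)
  show "((\<lambda>t. a + t * b) \<longlongrightarrow> a) (at_right 0)"
    by (auto intro!: tendsto_eq_intros)
  show "\<forall>\<^sub>F t in at_right 0. 0 \<le> a + t * b"
    unfolding eventually_at_right_field
  proof (intro exI[of _ 1] conjI allI impI)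
    fix t :: real assume t: "0 < t" "t < 1"
    have "0 \<le> t * (a + t * b)"
      using assms[of t] t by (simp add: algebra_simps power2_eq_square)
    then show "0 \<le> a + t * b"
      using t by (simp add: zero_le_mult_iff)
  qed simp
qed simp

lemma norm_add_scaleR_sq:
  fixes p h :: "'a::real_inner"
  shows "(norm (p + t *\<^sub>R h))\<^sup>2 = (norm p)\<^sup>2 + t * (2 * (p \<bullet> h)) + t\<^sup>2 * (norm h)\<^sup>2"
  unfolding power2_norm_eq_inner
  by (simp add: inner_add_left inner_add_right inner_commute algebra_simps power2_eq_square)

section \<open>Riesz representation and the adjoint\<close>

lemma riesz_representation:
  fixes f :: "'a::{real_inner, complete_space} \<Rightarrow> real"
  assumes "bounded_linear f"
  obtains w where "\<And>x. f x = w \<bullet> x"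
proof -
  interpret f: bounded_linear f by fact
  obtain K where K: "\<And>x. norm (f x) \<le> norm x * K" using f.bounded by blast
  define J where "J x = (norm x)\<^sup>2 / 2 - f x" for x
  define m where "m = Inf (range J)"
  have "- (K\<^sup>2) / 2 \<le> J x" for x
  proof -
    have "f x \<le> norm x * K" using K[of x] by simp
    moreover have "0 \<le> (norm x - K)\<^sup>2" by simp
    ultimately show ?thesis by (simp add: J_def power2_diff)
  qed
  then have bdd: "bdd_below (range J)" by (auto intro!: bdd_belowI)
  have m_le: "m \<le> J x" for x
    unfolding m_def by (rule cInf_lower[OF _ bdd]) simp
  define \<epsilon> where "\<epsilon> n = inverse (real (Suc n))" for n
  have "\<exists>x. J x < m + \<epsilon> n" for n
    using cInf_lessD[of "range J" "m + \<epsilon> n"] by (auto simp: m_def \<epsilon>_def)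
  then obtain X where X: "\<And>n. J (X n) < m + \<epsilon> n" by metis
  \<comment> \<open>Parallelogram law: \<open>f\<close> is linear, so it cancels in the midpoint
    comparison, and the midpoint value is at least \<open>m\<close>.\<close>
  have dist_sq: "(norm (X i - X j))\<^sup>2 \<le> 4 * (\<epsilon> i + \<epsilon> j)" for i j
  proof -
    have "J (X i) + J (X j) - 2 * J ((1/2) *\<^sub>R (X i + X j)) = (norm (X i - X j))\<^sup>2 / 4"
      unfolding J_def power2_norm_eq_inner
      by (simp add: f.add f.scaleR inner_diff_left inner_diff_right inner_add_left inner_add_right
          inner_commute field_simps)
    with X[of i] X[of j] m_le[of "(1/2) *\<^sub>R (X i + X j)"] show ?thesis by argo
  qed
  have "Cauchy X"
  proof (rule metric_CauchyI)
    fix e :: real assume e: "0 < e"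
    \<comment> \<open>The bound \<open>e\<^sup>2 / 8\<close> makes
      \<open>4 * (\<epsilon> i + \<epsilon> j)\<close> smaller than \<open>e\<^sup>2\<close> for all
      later indices.\<close>
    obtain N where N: "\<epsilon> N < e\<^sup>2 / 8"
      using reals_Archimedean[of "e\<^sup>2 / 8"] e by (auto simp: \<epsilon>_def)
    have "dist (X i) (X j) < e" if "N \<le> i" "N \<le> j" for i j
    proof -
      have "\<epsilon> i \<le> \<epsilon> N" "\<epsilon> j \<le> \<epsilon> N"
        using that by (auto simp: \<epsilon>_def intro!: le_imp_inverse_le)
      then have "(norm (X i - X j))\<^sup>2 < e\<^sup>2"
        using dist_sq[of i j] N by argo
      then show ?thesis
        using e by (auto simp: dist_norm intro: power2_less_imp_less)
    qed
    then show "\<exists>M. \<forall>i\<ge>M. \<forall>j\<ge>M. dist (X i) (X j) < e" by blast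
  qed
  then obtain w where w: "X \<longlonglongrightarrow> w"
    using Cauchy_convergent convergent_def by blast
  have "(\<lambda>n. J (X n)) \<longlonglongrightarrow> J w"
    unfolding J_def by (intro tendsto_intros f.tendsto w) simp
  moreover have "(\<lambda>n. m + \<epsilon> n) \<longlonglongrightarrow> m + 0"
    unfolding \<epsilon>_def by (intro tendsto_intros LIMSEQ_inverse_real_of_nat)
  ultimately have "J w \<le> m + 0"
    using X by (intro LIMSEQ_le[of _ _ "\<lambda>n. m + \<epsilon> n"]) (auto intro: less_imp_le)
  then have min: "J w \<le> J z" for z using m_le[of z] by simp
  have nonneg: "0 \<le> w \<bullet> h - f h" for h
  proof (rule first_order_nonneg)
    show "0 \<le> t * (w \<bullet> h - f h) + t\<^sup>2 * ((norm h)\<^sup>2 / 2)" for t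
      using min[of "w + t *\<^sub>R h"]
      by (simp add: J_def f.add f.scaleR norm_add_scaleR_sq algebra_simps)
  qed
  have "f h = w \<bullet> h" for h
    using nonneg[of h] nonneg[of "- h"] by (simp add: linear_neg[OF f.linear])
  then show thesis using that by blast
qed

text \<open>\<open>adjoint\<close> is defined by choice, so its property holds once some adjoint
  exists; Riesz applied to \<open>\<lambda>a. C a \<bullet> b\<close> supplies one value for each
  \<open>b\<close>.\<close>

lemma inner_adjoint:
  fixes C :: "'a::{real_inner, complete_space} \<Rightarrow> 'b::real_inner"
  assumes "bounded_linear C"
  shows "C a \<bullet> b = a \<bullet> adjoint C b"
proof -
  have "\<exists>w. \<forall>a. C a \<bullet> b = a \<bullet> w" for b
  proof -
    have "bounded_linear (\<lambda>a. C a \<bullet> b)"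
      using assms by (intro bounded_linear_inner_left_comp)
    then show ?thesis
      by (metis riesz_representation inner_commute)
  qed
  then have "\<exists>D. \<forall>a b. C a \<bullet> b = a \<bullet> D b" by metis
  then show ?thesis
    unfolding adjoint_def by (rule someI2_ex) blast
qed

lemma linear_adjoint:
  fixes C :: "'a::{real_inner, complete_space} \<Rightarrow> 'b::real_inner"
  assumes "bounded_linear C"
  shows "linear (adjoint C)"
proof (rule linearI)
  show "adjoint C (b + b') = adjoint C b + adjoint C b'" for b b'
    by (rule vector_eq_ldot[THEN iffD1])
       (simp add: inner_add_right flip: inner_adjoint[OF assms])
  show "adjoint C (r *\<^sub>R b) = r *\<^sub>R adjoint C b" for r b
    by (rule vector_eq_ldot[THEN iffD1])
       (simp flip: inner_adjoint[OF assms])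
qed

section \<open>The two quadratic subproblems\<close>

text \<open>The directional derivative is nonnegative along both \<open>h\<close> and
  \<open>- h\<close>. Two general maps are used because the primal step pairs the identity with
  \<open>C\<close>, the dual step \<open>adjoint C\<close> with the identity.\<close>

lemma least_squares_normal_equation:
  fixes A :: "'a::real_vector \<Rightarrow> 'b::real_inner" and B :: "'a \<Rightarrow> 'c::real_inner"
  assumes A: "linear A" and B: "linear B"
    and min: "x minimizes (\<lambda>\<xi>. (norm (A \<xi> - a))\<^sup>2 + (norm (B \<xi> - b))\<^sup>2)"
  shows "(A x - a) \<bullet> A h + (B x - b) \<bullet> B h = 0"
proof -
  have nonneg: "0 \<le> 2 * ((A x - a) \<bullet> A h + (B x - b) \<bullet> B h)" for h
  proof (rule first_order_nonneg)
    fix t :: real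
    have "A (x + t *\<^sub>R h) - a = (A x - a) + t *\<^sub>R A h" "B (x + t *\<^sub>R h) - b = (B x - b) + t *\<^sub>R B h"
      by (simp_all add: linear_add[OF A] linear_scale[OF A] linear_add[OF B] linear_scale[OF B])
    moreover have "(norm (A x - a))\<^sup>2 + (norm (B x - b))\<^sup>2
        \<le> (norm (A (x + t *\<^sub>R h) - a))\<^sup>2 + (norm (B (x + t *\<^sub>R h) - b))\<^sup>2"
      using min by (auto simp: is_arg_min_linorder)
    ultimately show "0 \<le> t * (2 * ((A x - a) \<bullet> A h + (B x - b) \<bullet> B h)) + t\<^sup>2 * ((norm (A h))\<^sup>2 + (norm (B h))\<^sup>2)"
      by (simp only: norm_add_scaleR_sq) (simp add: distrib_left)
  qed
  show ?thesis
    using nonneg[of h] nonneg[of "- h"] by (simp add: linear_neg[OF A] linear_neg[OF B])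
qed

text \<open>Applying \<open>C\<close> to the primal normal equation shows that the residual
  \<open>C x - b\<close> solves the dual normal equation scaled by \<open>lam\<close>, whose
  solution is unique.\<close>

lemma coupled_least_squares:
  fixes C :: "'h::{real_inner, complete_space} \<Rightarrow> 'g::{real_inner, complete_space}"
  assumes C: "bounded_linear C" and lam: "lam > 0"
    and x: "x minimizes (\<lambda>\<xi>. (norm (\<xi> - a))\<^sup>2 + (norm (C \<xi> - b))\<^sup>2)"
    and \<nu>: "\<nu> minimizes (\<lambda>\<nu>. (norm (adjoint C \<nu> - inverse lam *\<^sub>R a))\<^sup>2
                               + (norm (\<nu> - - (inverse lam *\<^sub>R b)))\<^sup>2)"
  shows "lam *\<^sub>R \<nu> = C x - b" and "x = a - lam *\<^sub>R adjoint C \<nu>"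
proof -
  interpret C: bounded_linear C by fact
  note adj = inner_adjoint[OF C] and lin = linear_adjoint[OF C]
  have x_eq: "x - a + adjoint C (C x - b) = 0"
  proof (rule vector_eq_ldot[THEN iffD1], intro allI)
    fix h
    show "h \<bullet> (x - a + adjoint C (C x - b)) = h \<bullet> 0"
      using least_squares_normal_equation[OF linear_ident C.linear x, of h]
      by (simp add: inner_add_right inner_commute flip: adj)
  qed
  have \<nu>_eq: "C (adjoint C \<nu> - inverse lam *\<^sub>R a) + (\<nu> + inverse lam *\<^sub>R b) = 0"
  proof (rule vector_eq_rdot[THEN iffD1], intro allI)
    fix h
    show "(C (adjoint C \<nu> - inverse lam *\<^sub>R a) + (\<nu> + inverse lam *\<^sub>R b)) \<bullet> h = 0 \<bullet> h"
      using least_squares_normal_equation[OF lin linear_ident \<nu>, of h]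
      by (simp add: inner_add_left adj)
  qed
  \<comment> \<open>The difference \<open>d\<close> of the two candidates satisfies \<open>C C\<^sup>* d + d = 0\<close>, and \<open>C C\<^sup>* + 1\<close> is injective.\<close>
  define w where "w = C x - b"
  define d where "d = lam *\<^sub>R \<nu> - w"
  have \<nu>_sol: "C (lam *\<^sub>R adjoint C \<nu> - a) + (lam *\<^sub>R \<nu> + b) = 0"
    using arg_cong[OF \<nu>_eq, of "\<lambda>z. lam *\<^sub>R z"] lam
    by (simp add: algebra_simps C.add C.diff C.scaleR)
  have "adjoint C w - a = - x"
    using x_eq unfolding w_def by (simp only: add_eq_0_iff) simp
  then have w_sol: "C (adjoint C w - a) + (w + b) = 0"
    by (simp only: linear_neg[OF C.linear]) (simp add: w_def)
  have "C (adjoint C d) + d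
      = (C (lam *\<^sub>R adjoint C \<nu> - a) + (lam *\<^sub>R \<nu> + b)) - (C (adjoint C w - a) + (w + b))"
    by (simp add: d_def linear_diff[OF lin] linear_scale[OF lin] C.diff C.scaleR algebra_simps)
  then have "C (adjoint C d) + d = 0"
    by (simp add: \<nu>_sol w_sol)
  \<comment> \<open>Take the inner product with \<open>d\<close> and move \<open>C\<close>
    across.\<close>
  then have "(norm (adjoint C d))\<^sup>2 + (norm d)\<^sup>2 = 0"
    by (simp add: power2_norm_eq_inner flip: adj inner_add_left)
  then have "d = 0"
    by (simp add: sum_power2_eq_zero_iff)
  then show 1: "lam *\<^sub>R \<nu> = C x - b" by (simp add: d_def w_def)
  show "x = a - lam *\<^sub>R adjoint C \<nu>"
    using x_eq by (simp add: algebra_simps flip: 1 linear_scale[OF lin])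
qed

section \<open>Proximal steps and Moreau's decomposition\<close>

text \<open>Optimality of a proximal step: \<open>(p - s) / lam\<close> is a subgradient of
  \<open>u\<close> at \<open>s\<close>. Moving from \<open>s\<close> toward \<open>\<sigma>\<close>,
  convexity bounds the change of \<open>u\<close> linearly in \<open>t\<close>, and the quadratic
  contributes the inner product at first order.\<close>

lemma prox_subgradient:
  fixes u :: "'a::real_inner \<Rightarrow> ereal"
  assumes proper: "proper_fun u" and convex: "convex_fun u" and lam: "lam > 0"
    and min: "s minimizes (\<lambda>\<sigma>. u \<sigma> + ereal (1 / (2 * lam) * (norm (p - \<sigma>))\<^sup>2))"
  obtains r where "u s = ereal r" "\<And>\<sigma>. ereal (r + inverse lam *\<^sub>R (p - s) \<bullet> (\<sigma> - s)) \<le> u \<sigma>"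
proof -
  have le: "u s + ereal (1 / (2 * lam) * (norm (p - s))\<^sup>2) \<le> u \<sigma> + ereal (1 / (2 * lam) * (norm (p - \<sigma>))\<^sup>2)" for \<sigma>
    using min by (auto simp: is_arg_min_linorder)
  \<comment> \<open>Comparison with a point of finite value forces \<open>u s\<close> to be
    finite.\<close>
  obtain \<sigma>0 where "u \<sigma>0 \<noteq> \<infinity>" using proper by (auto simp: proper_fun_def)
  with le[of \<sigma>0] have "u s \<noteq> \<infinity>" by auto
  then obtain r where r: "u s = ereal r"
    using proper by (metis proper_fun_def ereal_cases)
  have "ereal (r + inverse lam *\<^sub>R (p - s) \<bullet> (\<sigma> - s)) \<le> u \<sigma>" for \<sigma>
  proof (cases "u \<sigma>")
    case (real q)
    have "0 \<le> (q - r) - inverse lam *\<^sub>R (p - s) \<bullet> (\<sigma> - s)"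
    proof (rule first_order_nonneg)
      fix t :: real assume t: "0 < t" "t \<le> 1"
      have "(1 - t) *\<^sub>R (s, r) + t *\<^sub>R (\<sigma>, q) \<in> ereal_epigraph u"
        using convex t r real unfolding convex_fun_def
        by (intro convexD) (auto simp: ereal_epigraph_def)
      then have "u ((1 - t) *\<^sub>R s + t *\<^sub>R \<sigma>) \<le> ereal ((1 - t) * r + t * q)"
        by (simp add: ereal_epigraph_def)
      then have "u ((1 - t) *\<^sub>R s + t *\<^sub>R \<sigma>)
            + ereal (1 / (2 * lam) * (norm (p - ((1 - t) *\<^sub>R s + t *\<^sub>R \<sigma>)))\<^sup>2)
          \<le> ereal ((1 - t) * r + t * q)
            + ereal (1 / (2 * lam) * (norm (p - ((1 - t) *\<^sub>R s + t *\<^sub>R \<sigma>)))\<^sup>2)"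
        by (rule add_right_mono)
      from order_trans[OF le this] have "ereal (r + 1 / (2 * lam) * (norm (p - s))\<^sup>2)
          \<le> ereal ((1 - t) * r + t * q + 1 / (2 * lam) * (norm (p - ((1 - t) *\<^sub>R s + t *\<^sub>R \<sigma>)))\<^sup>2)"
        by (simp only: r plus_ereal.simps)
      also have "p - ((1 - t) *\<^sub>R s + t *\<^sub>R \<sigma>) = (p - s) + t *\<^sub>R (s - \<sigma>)"
        by (simp add: algebra_simps)
      finally have "0 \<le> t * (q - r) + 1 / (2 * lam) * (t * (2 * ((p - s) \<bullet> (s - \<sigma>))) + t\<^sup>2 * (norm (s - \<sigma>))\<^sup>2)"
        by (simp only: norm_add_scaleR_sq) (simp add: algebra_simps)
      also have "\<dots> = t * ((q - r) - inverse lam *\<^sub>R (p - s) \<bullet> (\<sigma> - s))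
          + t\<^sup>2 * (1 / (2 * lam) * (norm (s - \<sigma>))\<^sup>2)"
      proof -
        have "(p - s) \<bullet> (s - \<sigma>) = - ((p - s) \<bullet> (\<sigma> - s))"
          by (simp add: inner_diff_right)
        then show ?thesis
          unfolding inner_scaleR_left by (simp add: divide_simps distrib_left right_diff_distrib)
      qed
      finally show "0 \<le> \<dots>" .
    qed
    then show ?thesis by (simp add: real)
  qed (use proper in \<open>auto simp: proper_fun_def\<close>)
  with r show thesis using that by blast
qed

text \<open>The subgradient \<open>w = (p - s) / lam\<close> makes Fenchel's inequality at
  \<open>s\<close> tight, while for \<open>\<mu>\<close> it holds as an inequality. Comparing the
  dual objective at \<open>\<mu>\<close> and at \<open>w\<close> then forces
  \<open>w = \<mu>\<close>.\<close>

lemma moreau_decomposition: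
  fixes u :: "'a::real_inner \<Rightarrow> ereal"
  assumes proper: "proper_fun u" and convex: "convex_fun u" and lam: "lam > 0"
    and s: "s minimizes (\<lambda>\<sigma>. u \<sigma> + ereal (1 / (2 * lam) * (norm (p - \<sigma>))\<^sup>2))"
    and \<mu>: "\<mu> minimizes (\<lambda>\<mu>. convex_conjugate u \<mu> + ereal (lam / 2 * (norm (inverse lam *\<^sub>R p - \<mu>))\<^sup>2))"
  shows "lam *\<^sub>R \<mu> = p - s"
proof -
  define w where "w = inverse lam *\<^sub>R (p - s)"
  obtain r where r: "u s = ereal r" and sub: "\<And>\<sigma>. ereal (r + w \<bullet> (\<sigma> - s)) \<le> u \<sigma>"
    using prox_subgradient[OF proper convex lam s] unfolding w_def by metis
  have conj_ge: "ereal (\<mu> \<bullet> s - r) \<le> convex_conjugate u \<mu>"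
    unfolding convex_conjugate_def by (rule SUP_upper2[of s]) (auto simp: r)
  have conj_w: "convex_conjugate u w \<le> ereal (w \<bullet> s - r)"
    unfolding convex_conjugate_def
  proof (rule SUP_least)
    fix \<sigma>
    show "ereal (w \<bullet> \<sigma>) - u \<sigma> \<le> ereal (w \<bullet> s - r)"
      using sub[of \<sigma>] by (cases "u \<sigma>") (auto simp: inner_diff_right)
  qed
  have "ereal (\<mu> \<bullet> s - r) + ereal (lam / 2 * (norm (inverse lam *\<^sub>R p - \<mu>))\<^sup>2)
      \<le> convex_conjugate u \<mu> + ereal (lam / 2 * (norm (inverse lam *\<^sub>R p - \<mu>))\<^sup>2)"
    by (rule add_right_mono[OF conj_ge])
  also have "\<dots> \<le> convex_conjugate u w + ereal (lam / 2 * (norm (inverse lam *\<^sub>R p - w))\<^sup>2)"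
    using \<mu> by (auto simp: is_arg_min_linorder)
  also have "\<dots> \<le> ereal (w \<bullet> s - r) + ereal (lam / 2 * (norm (inverse lam *\<^sub>R p - w))\<^sup>2)"
    by (rule add_right_mono[OF conj_w])
  finally have le: "\<mu> \<bullet> s + lam / 2 * (norm (inverse lam *\<^sub>R p - \<mu>))\<^sup>2
      \<le> w \<bullet> s + lam / 2 * (norm (inverse lam *\<^sub>R p - w))\<^sup>2"
    by simp
  have p_w: "inverse lam *\<^sub>R p - w = inverse lam *\<^sub>R s"
    by (simp add: w_def algebra_simps)
  \<comment> \<open>The factor 1 brings the sum into the shape of \<open>norm_add_scaleR_sq\<close>;
    the cross term of that expansion cancels the linear terms in \<open>le\<close>.\<close>
  have p_\<mu>: "inverse lam *\<^sub>R p - \<mu> = inverse lam *\<^sub>R s + 1 *\<^sub>R (w - \<mu>)"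
    by (simp add: w_def algebra_simps)
  have "lam / 2 * (norm (w - \<mu>))\<^sup>2 \<le> 0"
  proof -
    have "lam / 2 * (norm (inverse lam *\<^sub>R s + 1 *\<^sub>R (w - \<mu>)))\<^sup>2
        = lam / 2 * (norm (inverse lam *\<^sub>R s))\<^sup>2 + (w \<bullet> s - \<mu> \<bullet> s) + lam / 2 * (norm (w - \<mu>))\<^sup>2"
      unfolding norm_add_scaleR_sq using lam
      by (simp add: distrib_left inner_diff_right inner_commute)
    then show ?thesis
      using le unfolding p_w p_\<mu> by linarith
  qed
  then have "w = \<mu>"
    using lam by (simp add: mult_le_0_iff)
  then show ?thesis
    using lam by (auto simp: w_def)
qed

section \<open>Induction over the iterations\<close>

theorem corollary1:
  fixes C :: "'h::{real_inner, complete_space} \<Rightarrow> 'g::{real_inner, complete_space}"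
    and u :: "'h \<Rightarrow> ereal" and v :: "'g \<Rightarrow> ereal" and lam :: real
    and x s zs :: "nat \<Rightarrow> 'h" and y zy :: "nat \<Rightarrow> 'g"
    and bv t zt :: "nat \<Rightarrow> 'g" and bu zu :: "nat \<Rightarrow> 'h"
  assumes "bounded_linear C"
    and "proper_fun u" and "closed_fun u" and "convex_fun u"
    and "proper_fun v" and "closed_fun v" and "convex_fun v"
    and "lam > 0"
    and "adm_primal C u v lam x s y zs zy"
    and "adm_dual C u v lam bv bu t zu zt"
    and "zy 0 = t 0" and "zs 0 = bu 0" and "s 0 = - zu 0" and "y 0 = zt 0"
  shows "\<forall>k\<ge>1. zy k = t k \<and> zs k = bu k \<and> s k = - zu k \<and> y k = zt k"
proof -
  note lam = \<open>lam > 0\<close>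
  have "zy k = t k \<and> zs k = bu k \<and> s k = - zu k \<and> y k = zt k" for k
  proof (induction k)
    case 0
    show ?case using assms by simp
  next
    case (Suc k)
    note P = assms(9)[unfolded adm_primal_def, rule_format, of k]
    note D = assms(10)[unfolded adm_dual_def, rule_format, of k]
    define a where "a = s k - lam *\<^sub>R zs k"
    define b where "b = y k - lam *\<^sub>R zy k"
    have prim: "x (Suc k) minimizes (\<lambda>\<xi>. (norm (\<xi> - a))\<^sup>2 + (norm (C \<xi> - b))\<^sup>2)"
      using P by (simp add: a_def b_def algebra_simps)
    \<comment> \<open>By the induction hypothesis \<open>bu k + zu k / lam = - a / lam\<close> and
      \<open>zt k / lam - t k = b / lam\<close>, so both iterations solve quadratic problems with
      the same data.\<close>
    have eqs: "adjoint C \<nu> + bu k + inverse lam *\<^sub>R zu k = adjoint C \<nu> - inverse lam *\<^sub>R a"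
      "\<nu> - t k + inverse lam *\<^sub>R zt k = \<nu> - - (inverse lam *\<^sub>R b)" for \<nu>
      using Suc lam by (simp_all add: a_def b_def algebra_simps)
    have dual: "bv (Suc k) minimizes (\<lambda>\<nu>. (norm (adjoint C \<nu> - inverse lam *\<^sub>R a))\<^sup>2
                               + (norm (\<nu> - - (inverse lam *\<^sub>R b)))\<^sup>2)"
      using D unfolding eqs by blast
    note x_bv = coupled_least_squares[OF assms(1) lam prim dual]
    \<comment> \<open>\<open>p\<close> and \<open>q\<close> are the centres of the primal proximal
      steps; the relations between \<open>x\<close> and \<open>bv\<close> express them in dual
      variables.\<close>
    define p where "p = x (Suc k) + lam *\<^sub>R zs k"
    define q where "q = C (x (Suc k)) + lam *\<^sub>R zy k"
    have p_dual: "p = - (zu k + lam *\<^sub>R adjoint C (bv (Suc k)))"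
      using x_bv(2) Suc by (simp add: p_def a_def algebra_simps)
    have q_dual: "q = zt k + lam *\<^sub>R bv (Suc k)"
      using x_bv(1) Suc by (simp add: q_def b_def algebra_simps)
    have eqs: "x (Suc k) - \<sigma> + lam *\<^sub>R zs k = p - \<sigma>"
      "C (x (Suc k)) - \<eta> + lam *\<^sub>R zy k = q - \<eta>" for \<sigma> \<eta>
      by (simp_all add: p_def q_def)
    have s: "s (Suc k) minimizes (\<lambda>\<sigma>. u \<sigma> + ereal (1 / (2 * lam) * (norm (p - \<sigma>))\<^sup>2))"
      and y: "y (Suc k) minimizes (\<lambda>\<eta>. v \<eta> + ereal (1 / (2 * lam) * (norm (q - \<eta>))\<^sup>2))"
      using P unfolding eqs by blast+
    \<comment> \<open>The dual constraint has a plus sign, so the argument is the negative of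
      \<open>p / lam - \<mu>\<close>; the norm absorbs this.\<close>
    have "norm (adjoint C (bv (Suc k)) + \<mu> + inverse lam *\<^sub>R zu k) = norm (inverse lam *\<^sub>R p - \<mu>)" for \<mu>
    proof -
      have "adjoint C (bv (Suc k)) + \<mu> + inverse lam *\<^sub>R zu k = - (inverse lam *\<^sub>R p - \<mu>)"
        using lam by (simp add: p_dual algebra_simps)
      then show ?thesis by (simp only: norm_minus_cancel)
    qed
    with D have bu: "bu (Suc k) minimizes
        (\<lambda>\<mu>. convex_conjugate u \<mu> + ereal (lam / 2 * (norm (inverse lam *\<^sub>R p - \<mu>))\<^sup>2))"
      by simp
    have "bv (Suc k) - \<tau> + inverse lam *\<^sub>R zt k = inverse lam *\<^sub>R q - \<tau>" for \<tau>
      using lam by (simp add: q_dual algebra_simps)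
    with D have t: "t (Suc k) minimizes
        (\<lambda>\<tau>. convex_conjugate v \<tau> + ereal (lam / 2 * (norm (inverse lam *\<^sub>R q - \<tau>))\<^sup>2))"
      by simp
    have bu_eq: "lam *\<^sub>R bu (Suc k) = p - s (Suc k)"
      using moreau_decomposition[OF assms(2,4) lam s bu] .
    have t_eq: "lam *\<^sub>R t (Suc k) = q - y (Suc k)"
      using moreau_decomposition[OF assms(5,7) lam y t] .
    have "zs (Suc k) = zs k + inverse lam *\<^sub>R (x (Suc k) - s (Suc k))"
      and "zy (Suc k) = zy k + inverse lam *\<^sub>R (C (x (Suc k)) - y (Suc k))"
      using P by blast+
    \<comment> \<open>In this form the primal multipliers are exactly the dual proximal points given
      by Moreau's decomposition.\<close>
    then have "lam *\<^sub>R zs (Suc k) = p - s (Suc k)" "lam *\<^sub>R zy (Suc k) = q - y (Suc k)"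
      using lam by (simp_all add: p_def q_def scaleR_add_right)
    then have "zs (Suc k) = bu (Suc k)" "zy (Suc k) = t (Suc k)"
      using bu_eq t_eq lam by (metis less_irrefl scaleR_cancel_left)+
    \<comment> \<open>The dual multiplier updates read
      \<open>zu (Suc k) = lam *\<^sub>R bu (Suc k) - p\<close> and
      \<open>zt (Suc k) = q - lam *\<^sub>R t (Suc k)\<close>.\<close>
    moreover have "s (Suc k) = - zu (Suc k)" "y (Suc k) = zt (Suc k)"
      using D bu_eq t_eq by (simp_all add: p_dual q_dual algebra_simps)
    ultimately show ?case by simp
  qed
  then show ?thesis by blast
qed

end
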